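(* Let $A$, $B$, $C$ and $D$ be convex cones in $\mathbb{R}^n$, $n\ge2$, with apex the origin $O$. Assume that each of them either coincides with $\{O\}$ or has non-empty interior and, moreover, $A\cup B\subset\{(x_1,x_2,\dots,x_n)\in\mathbb{R}^n: x_n\ge0\}$, $A\cap\{x_n=0\}=B\cap\{x_n=0\}=\{O\}$, $C\cup D\subset\{x_n\le0\}$ and $\operatorname{conv}(C\cup D)$ is pointed. If $$g_{A,C}+g_{B,D}=g_{A,D}+g_{B,C}$$ then either $A=B$ or $C=D$. The same conclusion holds if the hypothesis "$\operatorname{conv}(C\cup D)$ is pointed" is substituted by "either $A\subset B$ or $B\subset A$, and, moreover, either $C\subset D$ or $D\subset C$".
   Context: For convex sets $K,L\subset\mathbb{R}^n$, the cross covariogram of $K$ and $L$ is the function $g_{K,L}(x)=\lambda_n(K\cap(L+x))$, where $x\in\mathbb{R}^n$ is such that $\lambda_n(K\cap(L+x))$ is finite; $\lambda_n$ is $n$-dimensional Lebesgue measure. $\operatorname{conv}$ denotes convex hull. A convex cone is pointed if its apex is a vertex.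
   Formalization: The convex cones A, B, C, D are assumed closed; without this the claim fails, e.g. B closed with interior, A = {O} ∪ int B, C with interior, D = {O}: the covariogram identity holds although A ≠ B and C ≠ D. *)

theory Defs
  imports "HOL-Analysis.Analysis"
begin

(* The cross covariogram is only defined at those x where the measure below is finite;
   elsewhere "measure" returns the dummy value 0.  For the cones considered here the measure
   is finite at every x, see cross_covariogram_finite. *)
definition cross_covariogram ::
    "(real ^ 'n) set \<Rightarrow> (real ^ 'n) set \<Rightarrow> real ^ 'n \<Rightarrow> real"
  where "cross_covariogram K L x = measure lebesgue (K \<inter> (\<lambda>y. y + x) ` L)"

(* For convex cones with apex the origin.  The vertices of a convex set are its extreme points,
   that is, its 0-dimensional faces (face_of_singleton). *)
definition pointed_cone :: "(real ^ 'n) set \<Rightarrow> bool"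
  where "pointed_cone K \<longleftrightarrow> convex_cone K \<and> 0 extreme_point_of K"

lemma cross_covariogram_finite:
  fixes K L :: "(real ^ 'n) set" and k :: 'n
  assumes K: "convex_cone K" "closed K" "K \<subseteq> {x. 0 \<le> x $ k}" "K \<inter> {x. x $ k = 0} = {0}"
    and L: "closed L" "L \<subseteq> {x. x $ k \<le> 0}"
  shows "K \<inter> (\<lambda>y. y + x) ` L \<in> lmeasurable"
proof -
  let ?S = "K \<inter> sphere 0 1"
  have "\<exists>m>0. \<forall>y\<in>?S. m \<le> y $ k"
  proof (cases "?S = {}")
    case True
    then show ?thesis by (intro exI[of _ 1]) auto
  next
    case False
    have "compact ?S" using K(2) by (simp add: closed_Int_compact)
    moreover have "continuous_on ?S (\<lambda>y. y $ k)" by (intro continuous_intros)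
    ultimately obtain z where z: "z \<in> ?S" "\<forall>y\<in>?S. z $ k \<le> y $ k"
      using continuous_attains_inf False by blast
    have "z \<noteq> 0" using z(1) by auto
    then have "z $ k \<noteq> 0" using z(1) K(4) by blast
    moreover have "0 \<le> z $ k" using z(1) K(3) by blast
    ultimately show ?thesis using z(2) by (intro exI[of _ "z $ k"]) auto
  qed
  then obtain m where m: "m > 0" "\<And>y. y \<in> ?S \<Longrightarrow> m \<le> y $ k" by blast
  have "K \<inter> (\<lambda>y. y + x) ` L \<subseteq> cball 0 (\<bar>x $ k\<bar> / m)"
  proof
    fix y assume y: "y \<in> K \<inter> (\<lambda>y. y + x) ` L"
    then have le: "y $ k \<le> x $ k" using L(2) by auto
    show "y \<in> cball 0 (\<bar>x $ k\<bar> / m)"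
    proof (cases "y = 0")
      case True
      then show ?thesis using m(1) by simp
    next
      case False
      have "(1 / norm y) *\<^sub>R y \<in> ?S"
        using y K(1) False by (auto intro!: convex_cone_scaleR)
      from m(2)[OF this] have "m * norm y \<le> y $ k"
        using False by (simp add: field_simps)
      then show ?thesis using le m(1) by (simp add: field_simps)
    qed
  qed
  then have "bounded (K \<inter> (\<lambda>y. y + x) ` L)"
    using bounded_cball bounded_subset by blast
  moreover have "(\<lambda>y. y + x) ` L = (+) x ` L" by (simp add: add.commute)
  then have "closed (K \<inter> (\<lambda>y. y + x) ` L)"
    using K(2) L(1) closed_translation by (metis closed_Int)
  ultimately show ?thesis
    by (simp add: compact_eq_bounded_closed lmeasurable_compact)
qed

end

theory Submission
  imports Defs "HOL-Complex_Analysis.Complex_Analysis"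
begin

text \<open>
  The hypothesis says that the convolution of \<open>f = 1\<^sub>A - 1\<^sub>B\<close> with \<open>h = 1\<^sub>C\<^sub>' - 1\<^sub>D\<^sub>'\<close> vanishes, where
  \<open>C' = - C\<close> and \<open>D' = - D\<close>.

  If the hull of \<open>C \<union> D\<close> is pointed, some linear functional is strictly positive on \<open>A\<close>, \<open>B\<close>, \<open>C'\<close> and
  \<open>D'\<close> away from the origin, and hence so are all functionals in a neighbourhood \<open>U\<close> of it.  There the
  Laplace transforms \<open>L\<^sub>K u = \<integral>\<^sub>K exp (- (u \<bullet> y)) dy\<close> are finite, and the convolution theorem
  (\<open>laplace_mult\<close>) gives \<open>(L\<^sub>A - L\<^sub>B) (L\<^sub>C\<^sub>' - L\<^sub>D\<^sub>') = 0\<close> on \<open>U\<close>.  The transforms are analytic along lines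
  (\<open>claplace_holomorphic\<close>), so one of the two factors vanishes wherever it is defined
  (\<open>laplace_zero_divisor_free\<close>).

  The Laplace transform of a closed convex cone with nonempty interior is finite exactly on the interior
  of the dual cone (\<open>laplace_finite\<close>, \<open>laplace_infinite\<close>).  Thus the transforms of two distinct cones
  cannot coincide on the common part of these domains: one of them would have to stay bounded while
  its argument leaves its domain of finiteness (\<open>laplace_separates\<close>).  Hence \<open>A = B\<close> or \<open>C = D\<close>.

  If instead the two pairs are nested, \<open>f\<close> and \<open>h\<close> have constant signs, and their convolution can vanish
  only if one of them vanishes almost everywhere (\<open>nested_cones_eq\<close>).
\<close>

section \<open>Integrability of exponentials\<close>

lemma power_le_fact_mult_exp:
  fixes x :: real
  assumes "x \<ge> 0"
  shows "x ^ n \<le> fact n * exp x"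
proof -
  have "inverse (fact n) * x ^ n \<le> exp x"
    using sum_le_suminf[OF summable_exp[of x], of "{n}"] assms by (simp add: exp_def scaleR_conv_of_real inverse_eq_divide)
  then show ?thesis by (simp add: field_simps)
qed

text \<open>A point \<open>y\<close> with \<open>k \<le> norm y < k + 1\<close> contributes at most \<open>exp (- c k)\<close> and lies in the ball of radius
  \<open>k + 1\<close>, whose volume grows only polynomially in \<open>k\<close>.\<close>

lemma nn_integral_exp_neg_norm_finite:
  fixes c :: real
  assumes "c > 0"
  shows "(\<integral>\<^sup>+ (y::'a::euclidean_space). ennreal (exp (- c * norm y)) \<partial>lborel) < \<infinity>"
proof -
  define n where "n = DIM('a)"
  define V where "V = unit_ball_vol (real n)"
  have V: "V \<ge> 0" by (simp add: V_def)
  define t where "t k = exp (- c * real k) * (V * real (Suc k) ^ n)" for k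
  have "(\<integral>\<^sup>+ (y::'a). ennreal (exp (- c * norm y)) \<partial>lborel)
      \<le> (\<integral>\<^sup>+ (y::'a). (\<Sum>k. ennreal (exp (- c * real k)) * indicator (ball 0 (real (Suc k))) y) \<partial>lborel)"
  proof (rule nn_integral_mono)
    fix y :: 'a
    define k where "k = nat \<lfloor>norm y\<rfloor>"
    have k: "real k \<le> norm y" "norm y < real (Suc k)"
      using floor_correct[of "norm y"] unfolding k_def
      by (simp_all add: of_nat_nat del: one_add_floor) linarith
    have "ennreal (exp (- c * norm y)) \<le> ennreal (exp (- c * real k)) * indicator (ball 0 (real (Suc k))) y"
      using k assms by (auto intro!: ennreal_leI)
    also have "\<dots> \<le> (\<Sum>k. ennreal (exp (- c * real k)) * indicator (ball 0 (real (Suc k))) y)"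
    proof -
      have "g k \<le> suminf g" for g :: "nat \<Rightarrow> ennreal"
        using sum_le_suminf[of g "{k}"] by simp
      then show ?thesis .
    qed
    finally show "ennreal (exp (- c * norm y)) \<le> \<dots>" .
  qed
  also have "\<dots> = (\<Sum>k. \<integral>\<^sup>+ (y::'a). ennreal (exp (- c * real k)) * indicator (ball 0 (real (Suc k))) y \<partial>lborel)"
  proof (rule nn_integral_suminf)
    fix k :: nat
    have "ball (0::'a) (real (Suc k)) \<in> sets lborel" by simp
    then show "(\<lambda>y::'a. ennreal (exp (- c * real k)) * indicator (ball 0 (real (Suc k))) y) \<in> borel_measurable lborel"
      by (intro borel_measurable_times_ennreal borel_measurable_const borel_measurable_indicator)
  qed
  also have "\<dots> = (\<Sum>k. ennreal (t k))"
  proof (rule suminf_cong)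
    fix k
    have "emeasure lborel (ball (0::'a) (real (Suc k))) = ennreal (V * real (Suc k) ^ n)"
      unfolding V_def n_def by (rule emeasure_ball) simp
    then show "(\<integral>\<^sup>+ (y::'a). ennreal (exp (- c * real k)) * indicator (ball 0 (real (Suc k))) y \<partial>lborel) = ennreal (t k)"
      using V by (simp add: nn_integral_cmult_indicator t_def ennreal_mult)
  qed
  also have "\<dots> = ennreal (\<Sum>k. t k)"
  proof (rule suminf_ennreal2)
    show "t k \<ge> 0" for k using V by (simp add: t_def)
    \<comment> \<open>Half of the exponential decay absorbs the power \<open>(k + 1) ^ n\<close>.\<close>
    define M where "M = V * (2 / c) ^ n * fact n * exp (c / 2)"
    have "norm (t k) \<le> M * exp (- c / 2) ^ k" for k
    proof -
      have "(c / 2 * real (Suc k)) ^ n \<le> fact n * exp (c / 2 * real (Suc k))"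
        using assms by (intro power_le_fact_mult_exp) simp
      then have "(2 / c) ^ n * (c / 2 * real (Suc k)) ^ n \<le> (2 / c) ^ n * (fact n * exp (c / 2 * real (Suc k)))"
        using assms by (intro mult_left_mono) auto
      moreover have "(2 / c) ^ n * (c / 2 * real (Suc k)) ^ n = real (Suc k) ^ n"
      proof -
        have "2 / c * (c / 2 * real (Suc k)) = real (Suc k)" using assms by simp
        then show ?thesis by (metis power_mult_distrib)
      qed
      ultimately have "t k \<le> exp (- c * real k) * (V * ((2 / c) ^ n * (fact n * exp (c / 2 * real (Suc k)))))"
        unfolding t_def using V by (intro mult_left_mono) auto
      also have "\<dots> = V * (2 / c) ^ n * fact n * (exp (- c * real k) * exp (c / 2 * real (Suc k)))"
        by (simp add: mult_ac)
      also have "exp (- c * real k) * exp (c / 2 * real (Suc k)) = exp (c / 2) * exp (- c / 2) ^ k"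
      proof -
        have "exp (- c / 2) ^ k = exp (real k * (- c / 2))" by (rule exp_of_nat_mult[symmetric])
        then show ?thesis by (simp only: mult_exp_exp) (simp add: field_simps)
      qed
      finally have "t k \<le> M * exp (- c / 2) ^ k" by (simp only: M_def mult_ac)
      moreover have "t k \<ge> 0" using V by (simp add: t_def)
      ultimately show ?thesis by simp
    qed
    moreover have "summable (\<lambda>k. M * exp (- c / 2) ^ k)"
      using assms by (intro summable_mult summable_geometric) simp
    ultimately show "summable t"
      by (rule summable_comparison_test'[rotated, where N = 0])
  qed
  finally show ?thesis by (rule order_le_less_trans) simp
qed

lemma integrable_exp_neg_norm:
  fixes c :: real
  assumes "c > 0"
  shows "integrable lborel (\<lambda>y::'a::euclidean_space. exp (- c * norm y))"
  by (rule integrableI_bounded) (use nn_integral_exp_neg_norm_finite[OF assms] in auto)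

lemma norm_exp_minus_one_le:
  fixes x :: complex
  shows "norm (exp x - 1) \<le> norm x * exp (norm x)"
proof -
  have "norm (exp x - exp 0) \<le> exp (norm x) * norm (x - 0)"
  proof (rule field_differentiable_bound[where S = "cball 0 (norm x)" and f' = exp])
    fix z :: complex assume "z \<in> cball 0 (norm x)"
    then have "Re z \<le> norm x" using complex_Re_le_cmod[of z] by simp
    then show "norm (exp z) \<le> exp (norm x)" by simp
  qed (auto intro!: derivative_eq_intros)
  then show ?thesis by (simp add: mult.commute)
qed

section \<open>The strict dual cone and the Laplace transform of a set\<close>

text \<open>The functionals that dominate a positive multiple of the norm on \<open>K\<close>.  For a closed cone these
  are the functionals that are positive on \<open>K - {0}\<close>, which form the interior of the dual cone; the
  quantitative form makes openness and the domination of \<open>exp (- (u \<bullet> y))\<close> on \<open>K\<close> immediate.\<close>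

definition strict_dual :: "'a::real_inner set \<Rightarrow> 'a set"
  where "strict_dual K = {u. \<exists>c>0. \<forall>y\<in>K. c * norm y \<le> u \<bullet> y}"

lemma open_strict_dual: "open (strict_dual K)"
  unfolding open_dist
proof
  fix u assume "u \<in> strict_dual K"
  then obtain c where c: "c > 0" "\<And>y. y \<in> K \<Longrightarrow> c * norm y \<le> u \<bullet> y"
    by (auto simp: strict_dual_def)
  show "\<exists>e>0. \<forall>v. dist v u < e \<longrightarrow> v \<in> strict_dual K"
  proof (intro exI[of _ "c/2"] conjI allI impI)
    fix v assume v: "dist v u < c/2"
    have "c/2 * norm y \<le> v \<bullet> y" if "y \<in> K" for y
    proof -
      have "\<bar>(v - u) \<bullet> y\<bar> \<le> norm (v - u) * norm y" by (rule Cauchy_Schwarz_ineq2)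
      also have "\<dots> \<le> c/2 * norm y" using v by (intro mult_right_mono) (auto simp: dist_norm)
      finally have "- (c/2 * norm y) \<le> v \<bullet> y - u \<bullet> y" by (simp only: inner_diff_left abs_le_iff) linarith
      then show ?thesis using c(2)[OF that] by (simp add: algebra_simps)
    qed
    then show "v \<in> strict_dual K" using c(1) by (auto simp: strict_dual_def intro!: exI[of _ "c/2"])
  qed (use c in auto)
qed

lemma convex_strict_dual: "convex (strict_dual K)"
proof (rule convexI)
  fix u v and a b :: real
  assume uv: "u \<in> strict_dual K" "v \<in> strict_dual K" and ab: "0 \<le> a" "0 \<le> b" "a + b = 1"
  from uv obtain c d where c: "c > 0" "\<And>y. y \<in> K \<Longrightarrow> c * norm y \<le> u \<bullet> y"
    and d: "d > 0" "\<And>y. y \<in> K \<Longrightarrow> d * norm y \<le> v \<bullet> y"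
    by (auto simp: strict_dual_def)
  have "min c d * norm y \<le> (a *\<^sub>R u + b *\<^sub>R v) \<bullet> y" if "y \<in> K" for y
  proof -
    have "min c d * norm y \<le> u \<bullet> y" "min c d * norm y \<le> v \<bullet> y"
      using c(2)[OF that] d(2)[OF that]
      by (meson dual_order.trans min.cobounded1 min.cobounded2 mult_right_mono norm_ge_zero)+
    then have "a * (min c d * norm y) + b * (min c d * norm y) \<le> a * (u \<bullet> y) + b * (v \<bullet> y)"
      using ab by (intro add_mono mult_left_mono) auto
    moreover have "a * (min c d * norm y) + b * (min c d * norm y) = min c d * norm y"
      using ab by (simp flip: distrib_right)
    ultimately show ?thesis by (simp add: inner_add_left)
  qed
  then show "a *\<^sub>R u + b *\<^sub>R v \<in> strict_dual K"
    using c(1) d(1) by (auto simp: strict_dual_def intro!: exI[of _ "min c d"])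
qed

text \<open>The Laplace transform of the indicator function of \<open>K\<close>.  With values in the extended nonnegative
  reals it is defined for every \<open>u\<close>, and divergence of the integral is expressed by the value \<open>\<infinity>\<close>.\<close>

definition laplace :: "'a::euclidean_space set \<Rightarrow> 'a \<Rightarrow> ennreal"
  where "laplace K u = (\<integral>\<^sup>+ y. ennreal (exp (- (u \<bullet> y))) * indicator K y \<partial>lborel)"

lemma laplace_finite:
  assumes "u \<in> strict_dual K"
  shows "laplace K u < \<infinity>"
proof -
  obtain c where c: "c > 0" "\<And>y. y \<in> K \<Longrightarrow> c * norm y \<le> u \<bullet> y"
    using assms by (auto simp: strict_dual_def)
  have "laplace K u \<le> (\<integral>\<^sup>+ (y::'a). ennreal (exp (- c * norm y)) \<partial>lborel)"
    unfolding laplace_def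
    by (intro nn_integral_mono) (auto simp: indicator_def c(2) intro!: ennreal_leI)
  then show ?thesis
    using nn_integral_exp_neg_norm_finite[OF c(1), where 'a='a] by (rule order_le_less_trans)
qed

section \<open>Analyticity of the Laplace transform along lines\<close>

text \<open>The Laplace transform of \<open>K\<close> along the line \<open>u + z w\<close>, with a complex parameter \<open>z\<close>.\<close>

definition claplace :: "'a::euclidean_space set \<Rightarrow> 'a \<Rightarrow> 'a \<Rightarrow> complex \<Rightarrow> complex"
  where "claplace K u w z =
    (\<integral>y. indicator K y *\<^sub>R exp (- complex_of_real (u \<bullet> y) - z * complex_of_real (w \<bullet> y)) \<partial>lborel)"

lemma claplace_of_real:
  assumes K: "K \<in> sets borel" and u: "u + t *\<^sub>R w \<in> strict_dual K"
  shows "claplace K u w (of_real t) = of_real (enn2real (laplace K (u + t *\<^sub>R w)))"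
proof -
  have "claplace K u w (of_real t) = (\<integral>y. complex_of_real (exp (- ((u + t *\<^sub>R w) \<bullet> y)) * indicator K y) \<partial>lborel)"
    unfolding claplace_def
    by (intro Bochner_Integration.integral_cong refl)
       (auto simp: indicator_def exp_of_real[symmetric] inner_add_left algebra_simps)
  also have "\<dots> = of_real (\<integral>y. exp (- ((u + t *\<^sub>R w) \<bullet> y)) * indicator K y \<partial>lborel)"
    by (simp only: integral_complex_of_real flip: of_real_mult)
  also have "(\<integral>y. exp (- ((u + t *\<^sub>R w) \<bullet> y)) * indicator K y \<partial>lborel) = enn2real (laplace K (u + t *\<^sub>R w))"
    unfolding laplace_def using K
    by (subst integral_eq_nn_integral) (auto simp: ennreal_mult' ennreal_indicator)
  finally show ?thesis .
qed

text \<open>Differentiation under the integral sign.  If \<open>c * norm y\<close> is a lower bound on \<open>K\<close> for the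
  functional at \<open>z\<close>, then for small \<open>h\<close> the difference quotients of the integrand are dominated by a
  constant multiple of \<open>exp (- (c/2) * norm y)\<close>.\<close>

lemma claplace_holomorphic:
  assumes K: "K \<in> sets borel"
  shows "claplace K u w holomorphic_on {z. u + Re z *\<^sub>R w \<in> strict_dual K}"
proof -
  have "claplace K u w field_differentiable (at z)" if z: "u + Re z *\<^sub>R w \<in> strict_dual K" for z
  proof -
    obtain c where c: "c > 0" "\<And>y. y \<in> K \<Longrightarrow> c * norm y \<le> (u + Re z *\<^sub>R w) \<bullet> y"
      using z by (auto simp: strict_dual_def)
    define f where "f s y = indicator K y *\<^sub>R exp (- complex_of_real (u \<bullet> y) - s * complex_of_real (w \<bullet> y))"
      for s y
    have cl: "claplace K u w s = (\<integral>y. f s y \<partial>lborel)" for s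
      by (simp add: claplace_def f_def)
    define D where "D y = - complex_of_real (w \<bullet> y) * f z y" for y
    note [measurable] = K
    have meas [measurable]: "f s \<in> borel_measurable lborel" for s
      unfolding f_def by measurable
    have normf: "norm (f z y) \<le> exp (- c * norm y)" for y
      using c(2)[of y] by (auto simp: f_def indicator_def inner_add_left)
    have shift: "f (z + h) y = f z y * exp (- h * complex_of_real (w \<bullet> y))" for h y
      by (auto simp: f_def indicator_def exp_add[symmetric] algebra_simps)
    \<comment> \<open>For \<open>norm h < e\<close> the factor \<open>exp (norm h * \<bar>w \<bullet> y\<bar>)\<close> costs at most \<open>exp (c/4 * norm y)\<close>;
      another such factor absorbs the linear factor \<open>norm y\<close>.\<close>
    define e where "e = c / (4 * (norm w + 1))"
    have e: "e > 0" using c(1) by (simp add: e_def add_nonneg_pos)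
    have bnd: "norm ((f (z + h) y - f z y) / h) \<le> 4 * norm w / c * exp (- (c/2) * norm y)"
      if h: "h \<noteq> 0" "norm h < e" for h y
    proof -
      have hw: "norm h * norm w \<le> c / 4"
      proof -
        have "norm h * norm w \<le> e * (norm w + 1)" using h e by (intro mult_mono) auto
        also have "\<dots> = c / 4" by (simp add: e_def add_nonneg_eq_0_iff divide_simps)
        finally show ?thesis .
      qed
      have wy: "\<bar>w \<bullet> y\<bar> \<le> norm w * norm y" by (rule Cauchy_Schwarz_ineq2)
      have "norm ((f (z + h) y - f z y) / h) = norm (f z y) * (norm (exp (- h * complex_of_real (w \<bullet> y)) - 1) / norm h)"
        by (simp add: shift norm_divide norm_mult flip: right_diff_distrib[where c = 1, simplified])
           (metis (no_types, opaque_lifting) mult.right_neutral norm_mult right_diff_distrib)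
      also have "\<dots> \<le> exp (- c * norm y) * ((norm w * norm y) * exp (c/4 * norm y))"
      proof (intro mult_mono normf)
        have "norm (exp (- h * complex_of_real (w \<bullet> y)) - 1) \<le>
            norm (- h * complex_of_real (w \<bullet> y)) * exp (norm (- h * complex_of_real (w \<bullet> y)))"
          by (rule norm_exp_minus_one_le)
        also have "\<dots> = norm h * (\<bar>w \<bullet> y\<bar> * exp (norm h * \<bar>w \<bullet> y\<bar>))" by (simp add: norm_mult)
        finally have 1: "norm (exp (- h * complex_of_real (w \<bullet> y)) - 1) / norm h \<le> \<bar>w \<bullet> y\<bar> * exp (norm h * \<bar>w \<bullet> y\<bar>)"
          using h by (simp add: field_simps)
        have "norm h * \<bar>w \<bullet> y\<bar> \<le> norm h * (norm w * norm y)" using wy by (intro mult_left_mono) auto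
        also have "\<dots> \<le> c/4 * norm y" using hw mult_right_mono[OF hw norm_ge_zero[of y]] by (simp add: mult.assoc)
        finally have "\<bar>w \<bullet> y\<bar> * exp (norm h * \<bar>w \<bullet> y\<bar>) \<le> (norm w * norm y) * exp (c/4 * norm y)"
          using wy by (intro mult_mono) auto
        with 1 show "norm (exp (- h * complex_of_real (w \<bullet> y)) - 1) / norm h \<le> \<dots>" by linarith
      qed auto
      also have "\<dots> \<le> exp (- c * norm y) * ((norm w * (4 / c * exp (c/4 * norm y))) * exp (c/4 * norm y))"
      proof (intro mult_left_mono mult_right_mono)
        have "c/4 * norm y \<le> exp (c/4 * norm y)" using exp_ge_add_one_self[of "c/4 * norm y"] by linarith
        then show "norm y \<le> 4 / c * exp (c/4 * norm y)" using c(1) by (simp add: field_simps)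
      qed auto
      also have "\<dots> = 4 * norm w / c * (exp (- c * norm y) * exp (c/4 * norm y) * exp (c/4 * norm y))"
        by (simp add: field_simps)
      also have "exp (- c * norm y) * exp (c/4 * norm y) * exp (c/4 * norm y) = exp (- (c/2) * norm y)"
        by (simp add: mult_exp_exp algebra_simps)
      finally show ?thesis .
    qed
    have intf: "integrable lborel (f s)" if s: "norm (s - z) < e" for s
    proof -
      define g where "g y = e * (4 * norm w / c * exp (- (c/2) * norm y)) + exp (- c * norm y)" for y :: 'a
      have "integrable lborel g"
        unfolding g_def using integrable_exp_neg_norm[of "c/2", where 'a='a] integrable_exp_neg_norm[of c, where 'a='a] c(1)
        by (intro Bochner_Integration.integrable_add integrable_mult_right) auto
      moreover have "norm (f s y) \<le> norm (g y)" for y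
      proof (cases "s = z")
        case True
        have "0 \<le> e * (4 * norm w / c * exp (- (c/2) * norm y))" using e c by simp
        then show ?thesis using normf[of y] True by (simp add: g_def)
      next
        case False
        have "norm (f s y - f z y) = norm (s - z) * norm ((f (z + (s - z)) y - f z y) / (s - z))"
          using False by (simp add: norm_divide)
        also have "\<dots> \<le> e * (4 * norm w / c * exp (- (c/2) * norm y))"
          using s e False bnd[of "s - z" y] by (intro mult_mono) auto
        finally have "norm (f s y) \<le> g y"
          using normf[of y] norm_triangle_ineq2[of "f s y" "f z y"] by (simp add: g_def)
        then show ?thesis by simp
      qed
      ultimately show ?thesis
        using Bochner_Integration.integrable_bound[of lborel g "f s"] meas[of s] by (simp add: AE_I2)
    qed
    \<comment> \<open>Dominated convergence is available for sequences, so the limit at \<open>0\<close> is tested on sequences,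
      after dropping the first terms to come within distance \<open>e\<close>.\<close>
    have "((\<lambda>h. (claplace K u w (z + h) - claplace K u w z) / h) \<longlongrightarrow> (\<integral>y. D y \<partial>lborel)) (at 0)"
      unfolding tendsto_at_iff_sequentially comp_def
    proof (intro allI impI)
      fix X :: "nat \<Rightarrow> complex"
      assume X0: "\<forall>i. X i \<in> UNIV - {0}" and X: "X \<longlonglongrightarrow> 0"
      obtain N where N: "\<And>i. i \<ge> N \<Longrightarrow> norm (X i) < e"
        using X e unfolding LIMSEQ_iff by force
      define Y where "Y i = X (i + N)" for i
      have Y: "Y i \<noteq> 0" "norm (Y i) < e" for i using X0 N by (auto simp: Y_def)
      have Y0: "Y \<longlonglongrightarrow> 0" unfolding Y_def using X by (rule LIMSEQ_ignore_initial_segment)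
      have eq: "(claplace K u w (z + Y i) - claplace K u w z) / Y i = (\<integral>y. (f (z + Y i) y - f z y) / Y i \<partial>lborel)" for i
        using intf[of z] intf[of "z + Y i"] e Y[of i]
        by (simp add: cl)
      have "(\<lambda>i. \<integral>y. (f (z + Y i) y - f z y) / Y i \<partial>lborel) \<longlonglongrightarrow> (\<integral>y. D y \<partial>lborel)"
      proof (rule integral_dominated_convergence[where w = "\<lambda>y. 4 * norm w / c * exp (- (c/2) * norm y)"])
        show "D \<in> borel_measurable lborel" unfolding D_def by measurable
        show "(\<lambda>y. (f (z + Y i) y - f z y) / Y i) \<in> borel_measurable lborel" for i by measurable
        show "integrable lborel (\<lambda>y::'a. 4 * norm w / c * exp (- (c/2) * norm y))"
          using integrable_exp_neg_norm[of "c/2", where 'a='a] c(1) by (intro integrable_mult_right) auto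
        show "AE y in lborel. norm ((f (z + Y i) y - f z y) / Y i) \<le> 4 * norm w / c * exp (- (c/2) * norm y)" for i
          using bnd Y by auto
        show "AE y in lborel. (\<lambda>i. (f (z + Y i) y - f z y) / Y i) \<longlonglongrightarrow> D y"
        proof (rule AE_I2)
          fix y
          have "((\<lambda>s. f s y) has_field_derivative D y) (at z)"
            unfolding f_def D_def
            by (auto intro!: derivative_eq_intros simp: indicator_def)
          then have "((\<lambda>h. (f (z + h) y - f z y) / h) \<longlongrightarrow> D y) (at 0)"
            by (simp add: DERIV_def)
          then show "(\<lambda>i. (f (z + Y i) y - f z y) / Y i) \<longlonglongrightarrow> D y"
            using Y0 Y by (auto simp: tendsto_at_iff_sequentially comp_def)
        qed
      qed
      then have "(\<lambda>i. (claplace K u w (z + Y i) - claplace K u w z) / Y i) \<longlonglongrightarrow> (\<integral>y. D y \<partial>lborel)"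
        by (simp only: eq)
      then show "(\<lambda>i. (claplace K u w (z + X i) - claplace K u w z) / X i) \<longlonglongrightarrow> (\<integral>y. D y \<partial>lborel)"
        unfolding Y_def by (rule LIMSEQ_offset)
    qed
    then show ?thesis unfolding field_differentiable_def DERIV_def by blast
  qed
  then show ?thesis by (auto simp: holomorphic_on_def intro: field_differentiable_at_within)
qed

text \<open>Isolated zeros: if the Laplace transforms of \<open>A\<close> and \<open>B\<close> differ at one point of a line, inside both
  strict duals, then near any point \<open>u\<close> of the line inside both strict duals they differ at every point of
  the line except possibly \<open>u\<close> itself.\<close>

lemma eventually_laplace_neq:
  assumes "A \<in> sets borel" "B \<in> sets borel"
    and u: "u \<in> strict_dual A \<inter> strict_dual B"
    and us: "u + s *\<^sub>R w \<in> strict_dual A \<inter> strict_dual B"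
    and neq: "laplace A (u + s *\<^sub>R w) \<noteq> laplace B (u + s *\<^sub>R w)"
  shows "\<forall>\<^sub>F t in at 0. laplace A (u + t *\<^sub>R w) \<noteq> laplace B (u + t *\<^sub>R w)"
proof -
  define S where "S = {z. u + Re z *\<^sub>R w \<in> strict_dual A \<inter> strict_dual B}"
  define \<phi> where "\<phi> z = claplace A u w z - claplace B u w z" for z
  have S_eq: "S = (\<lambda>z. u + Re z *\<^sub>R w) -` (strict_dual A \<inter> strict_dual B)"
    by (auto simp: S_def)
  have "open S"
    unfolding S_eq by (intro open_vimage open_Int open_strict_dual continuous_intros)
  have "convex S"
  proof (rule convexI)
    fix x y and a b :: real assume xy: "x \<in> S" "y \<in> S" and ab: "0 \<le> a" "0 \<le> b" "a + b = 1"
    have "a *\<^sub>R (u + Re x *\<^sub>R w) + b *\<^sub>R (u + Re y *\<^sub>R w) \<in> strict_dual A \<inter> strict_dual B"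
      using xy ab by (intro convexD[OF convex_Int[OF convex_strict_dual convex_strict_dual]]) (auto simp: S_def)
    moreover have "a *\<^sub>R (u + Re x *\<^sub>R w) + b *\<^sub>R (u + Re y *\<^sub>R w) = u + Re (a *\<^sub>R x + b *\<^sub>R y) *\<^sub>R w"
      using scaleR_left.add[of a b u] ab by (simp add: algebra_simps)
    ultimately show "a *\<^sub>R x + b *\<^sub>R y \<in> S" by (simp add: S_def)
  qed
  have \<phi>_real: "\<phi> (of_real t) = 0 \<longleftrightarrow> laplace A (u + t *\<^sub>R w) = laplace B (u + t *\<^sub>R w)"
    if "of_real t \<in> S" for t
  proof -
    have t: "u + t *\<^sub>R w \<in> strict_dual A" "u + t *\<^sub>R w \<in> strict_dual B"
      using that by (auto simp: S_def)
    show ?thesis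
      using laplace_finite[OF t(1)] laplace_finite[OF t(2)]
      by (simp add: \<phi>_def claplace_of_real assms t less_top[symmetric])
         (metis ennreal_enn2real infinity_ennreal_def top.not_eq_extremum)
  qed
  have "\<phi> holomorphic_on S"
    unfolding \<phi>_def S_def
    by (intro holomorphic_on_diff; rule holomorphic_on_subset[OF claplace_holomorphic]) (use assms in auto)
  moreover have "of_real s \<in> S" "0 \<in> S" using u us by (auto simp: S_def)
  ultimately have "\<forall>\<^sub>F z in at 0. \<phi> z \<noteq> 0 \<and> z \<in> S"
    using \<phi>_real[of s] neq \<open>open S\<close> convex_connected[OF \<open>convex S\<close>]
    by (intro non_zero_neighbour_alt[where \<beta> = "of_real s"]) auto
  moreover have "filterlim complex_of_real (at 0) (at 0)"
    by (auto simp: filterlim_at intro!: tendsto_eq_intros eventually_at_filter[THEN iffD2])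
  ultimately have "\<forall>\<^sub>F t in at 0. \<phi> (of_real t) \<noteq> 0 \<and> of_real t \<in> S"
    by (rule eventually_compose_filterlim)
  then show ?thesis by eventually_elim (use \<phi>_real in blast)
qed

section \<open>Distinct cones have distinct Laplace transforms\<close>

lemma strict_dualI:
  fixes K :: "'a::euclidean_space set"
  assumes K: "convex_cone K" "closed K" and pos: "\<And>y. y \<in> K \<Longrightarrow> y \<noteq> 0 \<Longrightarrow> 0 < u \<bullet> y"
  shows "u \<in> strict_dual K"
proof -
  let ?S = "K \<inter> sphere 0 1"
  have "\<exists>m>0. \<forall>y\<in>?S. m \<le> u \<bullet> y"
  proof (cases "?S = {}")
    case True
    then show ?thesis by (intro exI[of _ 1]) auto
  next
    case False
    have "compact ?S" using K(2) by (simp add: closed_Int_compact)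
    moreover have "continuous_on ?S (\<lambda>y. u \<bullet> y)" by (intro continuous_intros)
    ultimately obtain z where z: "z \<in> ?S" "\<forall>y\<in>?S. u \<bullet> z \<le> u \<bullet> y"
      using continuous_attains_inf False by blast
    from z(1) have "z \<noteq> 0" by auto
    with pos[of z] z show ?thesis by (intro exI[of _ "u \<bullet> z"]) auto
  qed
  then obtain m where m: "m > 0" "\<And>y. y \<in> ?S \<Longrightarrow> m \<le> u \<bullet> y" by blast
  have "m * norm y \<le> u \<bullet> y" if "y \<in> K" for y
  proof (cases "y = 0")
    case False
    then have "(1 / norm y) *\<^sub>R y \<in> ?S" using that K(1) by (auto intro!: convex_cone_scaleR)
    from m(2)[OF this] show ?thesis using False by (simp add: field_simps)
  qed simp
  then show ?thesis using m(1) by (auto simp: strict_dual_def)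
qed

text \<open>If \<open>u\<close> is not in the strict dual, some unit vector \<open>a\<close> of the cone has \<open>u \<bullet> a \<le> 0\<close>.  A ball inside the
  cone can be translated along \<open>a\<close> to infinitely many disjoint balls, on all of which the integrand is
  bounded below by the same positive constant.\<close>

lemma laplace_infinite:
  fixes K :: "'a::euclidean_space set"
  assumes K: "convex_cone K" "closed K" "interior K \<noteq> {}" and u: "u \<notin> strict_dual K"
  shows "laplace K u = \<infinity>"
proof (rule ccontr)
  assume fin: "laplace K u \<noteq> \<infinity>"
  obtain a0 where a0: "a0 \<in> K" "a0 \<noteq> 0" "u \<bullet> a0 \<le> 0"
    using strict_dualI[OF K(1,2)] u by (meson not_le)
  define a where "a = (1 / norm a0) *\<^sub>R a0"
  have a: "a \<in> K" "norm a = 1" "u \<bullet> a \<le> 0"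
    using a0 K(1) by (auto simp: a_def divide_nonpos_nonneg intro!: convex_cone_scaleR)
  obtain p r where r: "r > 0" "ball p r \<subseteq> K"
    using K(3) by (meson ex_in_conv mem_interior)
  \<comment> \<open>Steps of length \<open>2 * r\<close> make the translated open balls of radius \<open>r\<close> disjoint.\<close>
  define c where "c j = (2 * r * real j) *\<^sub>R a" for j
  define Q where "Q j = ball (p + c j) r" for j
  have QK: "Q j \<subseteq> K" for j
  proof
    fix y assume "y \<in> Q j"
    then have "y - c j \<in> ball p r" by (simp add: Q_def dist_norm algebra_simps)
    then have "y - c j \<in> K" using r by auto
    moreover have "c j \<in> K" using a r K(1) unfolding c_def by (auto intro!: convex_cone_scaleR)
    ultimately have "(y - c j) + c j \<in> K" using K(1) by (intro convex_cone_add)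
    then show "y \<in> K" by simp
  qed
  define M where "M = norm u * (norm p + r)"
  have QM: "u \<bullet> y \<le> M" if "y \<in> Q j" for y j
  proof -
    have "norm (y - c j - p) < r" using that by (simp add: Q_def dist_norm algebra_simps norm_minus_commute)
    then have "norm (y - c j) \<le> norm p + r" using norm_triangle_ineq2[of "y - c j" p] by linarith
    then have "norm u * norm (y - c j) \<le> M" unfolding M_def by (intro mult_left_mono) auto
    moreover have "u \<bullet> (y - c j) \<le> norm u * norm (y - c j)" by (rule norm_cauchy_schwarz)
    moreover have "u \<bullet> c j \<le> 0" using a r by (simp add: c_def mult_nonneg_nonpos)
    ultimately show ?thesis by (simp add: inner_diff_right)
  qed
  have disj: "disjoint_family Q"
    unfolding disjoint_family_on_def
  proof (intro ballI impI)
    fix i j :: nat assume "i \<noteq> j"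
    then have "1 \<le> \<bar>real i - real j\<bar>" by linarith
    then have "2 * r \<le> 2 * r * \<bar>real i - real j\<bar>" using r by simp
    also have "\<dots> = norm ((2 * r * (real i - real j)) *\<^sub>R a)" using r a by (simp add: abs_mult)
    also have "(2 * r * (real i - real j)) *\<^sub>R a = (p + c i) - (p + c j)"
      by (simp add: c_def algebra_simps)
    finally have "2 * r \<le> dist (p + c i) (p + c j)" by (simp add: dist_norm)
    then show "Q i \<inter> Q j = {}"
      unfolding Q_def by (intro disjoint_ballI) simp
  qed
  define V where "V = exp (- M) * measure lborel (ball p r)"
  have V: "V > 0" using content_ball_pos[OF r(1), of p] by (simp add: V_def)
  have emQ: "emeasure lborel (Q j) = ennreal (measure lborel (ball p r))" for j
  proof -
    have "emeasure lborel (Q j) = emeasure lborel (ball p r)"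
      unfolding Q_def using r by (simp add: emeasure_ball)
    moreover have "emeasure lborel (ball p r) \<noteq> \<infinity>"
      using emeasure_lborel_ball_finite[of p r] by simp
    ultimately show ?thesis by (simp add: emeasure_eq_ennreal_measure)
  qed
  have bound: "ennreal (real N * V) \<le> laplace K u" for N
  proof -
    have "(\<lambda>y. ennreal (exp (- M)) * indicator (Q j) y) \<in> borel_measurable lborel" for j
      unfolding Q_def by (intro borel_measurable_times_ennreal borel_measurable_const borel_measurable_indicator) simp
    then have "ennreal (real N * V) = (\<integral>\<^sup>+ y. (\<Sum>j<N. ennreal (exp (- M)) * indicator (Q j) y) \<partial>lborel)"
      by (subst nn_integral_sum)
         (auto simp: Q_def nn_integral_cmult_indicator emQ[unfolded Q_def] V_def ennreal_mult
           ennreal_of_nat_eq_real_of_nat)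
    also have "\<dots> \<le> laplace K u"
      unfolding laplace_def
    proof (rule nn_integral_mono)
      fix y
      show "(\<Sum>j<N. ennreal (exp (- M)) * indicator (Q j) y) \<le> ennreal (exp (- (u \<bullet> y))) * indicator K y"
      proof (cases "\<exists>i<N. y \<in> Q i")
        case True
        then obtain i where i: "i < N" "y \<in> Q i" by blast
        have "(\<Sum>j<N. ennreal (exp (- M)) * indicator (Q j) y) = (\<Sum>j\<in>{i}. ennreal (exp (- M)) * indicator (Q j) y)"
          using i disj by (intro sum.mono_neutral_right) (auto simp: disjoint_family_on_def indicator_def)
        also have "\<dots> \<le> ennreal (exp (- (u \<bullet> y))) * indicator K y"
          using i QK QM[OF i(2)] by (auto simp: indicator_def intro!: ennreal_leI)
        finally show ?thesis .
      next
        case False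
        then have "(\<Sum>j<N. ennreal (exp (- M)) * indicator (Q j) y) = 0"
          by (intro sum.neutral) (auto simp: indicator_def)
        then show ?thesis by simp
      qed
    qed
    finally show ?thesis .
  qed
  obtain l where l: "l \<ge> 0" "laplace K u = ennreal l"
    using fin by (cases "laplace K u") auto
  obtain N where "l < real N * V" using V reals_Archimedean3 by blast
  moreover have "real N * V \<le> l" using bound[of N] l by simp
  ultimately show False by simp
qed

text \<open>Let \<open>w\<close> separate a point \<open>a\<close> of \<open>A - B\<close> from \<open>B\<close>.  On the ray \<open>u + t w\<close>, \<open>t \<ge> 0\<close>, the transform of \<open>B\<close>
  is bounded by its value at \<open>u\<close>, whereas the ray leaves the strict dual of \<open>A\<close> at a finite parameter.
  If the transforms agreed on the intersection of the strict duals, then by Fatou's lemma that of \<open>A\<close>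
  would still be finite at the exit point, which is impossible since the strict dual is open.\<close>

lemma laplace_separates_aux:
  fixes A B :: "'a::euclidean_space set"
  assumes A: "convex_cone A" "closed A" "interior A \<noteq> {}" and B: "convex_cone B" "closed B"
    and u: "u \<in> strict_dual A \<inter> strict_dual B" and "\<not> A \<subseteq> B"
  shows "\<exists>v \<in> strict_dual A \<inter> strict_dual B. laplace A v \<noteq> laplace B v"
proof (rule ccontr)
  assume "\<not> ?thesis"
  then have eq: "laplace A v = laplace B v" if "v \<in> strict_dual A" "v \<in> strict_dual B" for v
    using that by blast
  obtain a where a: "a \<in> A" "a \<notin> B" using \<open>\<not> A \<subseteq> B\<close> by blast
  have "convex B" using B(1) by (simp add: convex_cone_def)
  then obtain w b where w: "w \<bullet> a < b" "\<And>x. x \<in> B \<Longrightarrow> w \<bullet> x > b"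
    using separating_hyperplane_closed_point[of B a] B(2) a(2) by blast
  have "b < 0" using w(2)[of 0] B(1) by (simp add: convex_cone_contains_0)
  then have wa: "w \<bullet> a < 0" using w(1) by simp
  have wB: "w \<bullet> x \<ge> 0" if "x \<in> B" for x
  proof (rule ccontr)
    assume neg: "\<not> w \<bullet> x \<ge> 0"
    have "(b / (w \<bullet> x)) *\<^sub>R x \<in> B"
      using that neg \<open>b < 0\<close> B(1) by (intro convex_cone_scaleR) (auto simp: divide_nonpos_nonpos)
    from w(2)[OF this] neg show False by simp
  qed
  have uB: "u + t *\<^sub>R w \<in> strict_dual B" and le: "laplace B (u + t *\<^sub>R w) \<le> laplace B u" if "t \<ge> 0" for t
  proof -
    have mono: "u \<bullet> y \<le> (u + t *\<^sub>R w) \<bullet> y" if "y \<in> B" for y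
      using wB[OF that] \<open>t \<ge> 0\<close> by (simp add: inner_add_left)
    obtain c where "c > 0" "\<And>y. y \<in> B \<Longrightarrow> c * norm y \<le> u \<bullet> y"
      using u by (auto simp: strict_dual_def)
    with mono show "u + t *\<^sub>R w \<in> strict_dual B"
      unfolding strict_dual_def by (blast intro: order_trans)
    show "laplace B (u + t *\<^sub>R w) \<le> laplace B u"
      unfolding laplace_def
      by (intro nn_integral_mono) (use mono in \<open>auto simp: indicator_def intro!: ennreal_leI\<close>)
  qed
  define T where "T = {t. t \<ge> 0 \<and> u + t *\<^sub>R w \<in> strict_dual A}"
  have "0 \<in> T" using u by (simp add: T_def)
  have "bdd_above T"
  proof (rule bdd_aboveI)
    fix t assume "t \<in> T"
    then obtain c where "c > 0" "\<And>y. y \<in> A \<Longrightarrow> c * norm y \<le> (u + t *\<^sub>R w) \<bullet> y"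
      by (auto simp: T_def strict_dual_def)
    then have "0 \<le> (u + t *\<^sub>R w) \<bullet> a"
      using a(1) by (meson mult_nonneg_nonneg norm_ge_zero order_less_imp_le order_trans)
    then show "t \<le> (u \<bullet> a) / - (w \<bullet> a)" using wa by (simp add: inner_add_left field_simps)
  qed
  \<comment> \<open>The exit parameter of the ray.\<close>
  define s where "s = Sup T"
  have "s \<in> closure T"
    unfolding s_def using \<open>0 \<in> T\<close> \<open>bdd_above T\<close> by (intro closure_contains_Sup) auto
  then obtain X where X: "\<And>n. X n \<in> T" "X \<longlonglongrightarrow> s"
    unfolding closure_sequential by blast
  have "laplace A (u + s *\<^sub>R w) = (\<integral>\<^sup>+ y. liminf (\<lambda>n. ennreal (exp (- ((u + X n *\<^sub>R w) \<bullet> y))) * indicator A y) \<partial>lborel)"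
    unfolding laplace_def
  proof (intro nn_integral_cong lim_imp_Liminf[symmetric])
    fix y
    show "(\<lambda>n. ennreal (exp (- ((u + X n *\<^sub>R w) \<bullet> y))) * indicator A y)
      \<longlonglongrightarrow> ennreal (exp (- ((u + s *\<^sub>R w) \<bullet> y))) * indicator A y"
      using X(2) by (cases "y \<in> A") (auto intro!: tendsto_intros)
  qed simp
  also have "\<dots> \<le> liminf (\<lambda>n. laplace A (u + X n *\<^sub>R w))"
    unfolding laplace_def using A(2) by (intro nn_integral_liminf) auto
  also have "\<dots> \<le> laplace B u"
  proof -
    have "laplace A (u + X n *\<^sub>R w) \<le> laplace B u" for n
      using X(1)[of n] eq[of "u + X n *\<^sub>R w"] uB[of "X n"] le[of "X n"] by (simp add: T_def)
    then have "liminf (\<lambda>n. laplace A (u + X n *\<^sub>R w)) \<le> liminf (\<lambda>n::nat. laplace B u)"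
      by (intro Liminf_mono) auto
    then show ?thesis by (simp add: Liminf_const)
  qed
  also have "\<dots> < \<infinity>" using u laplace_finite[of u B] by simp
  finally have "u + s *\<^sub>R w \<in> strict_dual A"
    using laplace_infinite[OF A] by fastforce
  moreover have "open ((\<lambda>t. u + t *\<^sub>R w) -` strict_dual A)"
    by (intro open_vimage open_strict_dual continuous_intros)
  ultimately obtain e where e: "e > 0" "\<And>t. dist t s < e \<Longrightarrow> u + t *\<^sub>R w \<in> strict_dual A"
    unfolding open_dist by force
  have "s \<ge> 0" unfolding s_def using \<open>0 \<in> T\<close> \<open>bdd_above T\<close> by (intro cSup_upper)
  then have "s + e/2 \<in> T" using e by (auto simp: T_def dist_real_def)
  then have "s + e/2 \<le> s" unfolding s_def using \<open>bdd_above T\<close> by (intro cSup_upper)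
  then show False using e by simp
qed

text \<open>A degenerate cone \<open>{0}\<close> is contained in every other cone, so of two distinct cones the one that is
  not contained in the other has nonempty interior.\<close>

lemma laplace_separates:
  fixes A B :: "'a::euclidean_space set"
  assumes A: "convex_cone A" "closed A" "A = {0} \<or> interior A \<noteq> {}"
    and B: "convex_cone B" "closed B" "B = {0} \<or> interior B \<noteq> {}"
    and u: "u \<in> strict_dual A \<inter> strict_dual B" and "A \<noteq> B"
  shows "\<exists>v \<in> strict_dual A \<inter> strict_dual B. laplace A v \<noteq> laplace B v"
proof (cases "A \<subseteq> B")
  case False
  then have "interior A \<noteq> {}" using A(3) B(1) convex_cone_contains_0 by blast
  then show ?thesis using laplace_separates_aux[OF A(1,2) _ B(1,2) u False] by blast
next
  case True
  then have "\<not> B \<subseteq> A" using \<open>A \<noteq> B\<close> by blast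
  moreover from this have "interior B \<noteq> {}" using B(3) A(1) convex_cone_contains_0 by blast
  ultimately have "\<exists>v \<in> strict_dual B \<inter> strict_dual A. laplace B v \<noteq> laplace A v"
    using laplace_separates_aux[OF B(1,2) _ A(1,2), of u] u by blast
  then show ?thesis by force
qed

section \<open>Laplace transforms and cross covariograms\<close>

lemma emeasure_Int_translation:
  fixes A C :: "'a::euclidean_space set"
  assumes [measurable]: "A \<in> sets borel" "C \<in> sets borel"
  shows "emeasure lborel (A \<inter> (\<lambda>y. y + x) ` C) = (\<integral>\<^sup>+ y. indicator A y * indicator C (y - x) \<partial>lborel)"
proof -
  have set_eq: "A \<inter> (\<lambda>y. y + x) ` C = {y. y \<in> A \<and> y - x \<in> C}"
    by (auto simp: image_iff) (metis diff_add_cancel)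
  have "emeasure lborel (A \<inter> (\<lambda>y. y + x) ` C) = (\<integral>\<^sup>+ y. indicator (A \<inter> (\<lambda>y. y + x) ` C) y \<partial>lborel)"
    unfolding set_eq by (intro nn_integral_indicator[symmetric]) measurable
  also have "\<dots> = (\<integral>\<^sup>+ y. indicator A y * indicator C (y - x) \<partial>lborel)"
    unfolding set_eq by (intro nn_integral_cong) (auto simp: indicator_def)
  finally show ?thesis .
qed

text \<open>The cross covariogram of \<open>A\<close> and \<open>C\<close> is the convolution of the indicators of \<open>A\<close> and \<open>- C\<close>, so its
  Laplace transform is the product of theirs.\<close>

lemma laplace_mult:
  fixes A C :: "'a::euclidean_space set"
  assumes [measurable]: "A \<in> sets borel" "C \<in> sets borel"
  shows "laplace A u * laplace (uminus ` C) u =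
    (\<integral>\<^sup>+ x. ennreal (exp (- (u \<bullet> x))) * emeasure lborel (A \<inter> (\<lambda>y. y + x) ` C) \<partial>lborel)"
proof -
  define F where "F x y = ennreal (exp (- (u \<bullet> x))) * (indicator A y * indicator C (y - x))" for x y :: 'a
  have [measurable]: "(\<lambda>(x, y). F x y) \<in> borel_measurable (lborel \<Otimes>\<^sub>M lborel)"
    unfolding F_def by measurable
  have [measurable]: "F x \<in> borel_measurable lborel" "(\<lambda>x. F x y) \<in> borel_measurable lborel" for x y
    unfolding F_def by measurable
  have neg: "indicator (uminus ` C) z = (indicator C (- z) :: ennreal)" for z
    by (auto simp: indicator_def image_iff) (metis minus_minus)
  have "(\<integral>\<^sup>+ x. ennreal (exp (- (u \<bullet> x))) * emeasure lborel (A \<inter> (\<lambda>y. y + x) ` C) \<partial>lborel)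
      = (\<integral>\<^sup>+ x. \<integral>\<^sup>+ y. F x y \<partial>lborel \<partial>lborel)"
  proof (rule nn_integral_cong)
    fix x
    show "ennreal (exp (- (u \<bullet> x))) * emeasure lborel (A \<inter> (\<lambda>y. y + x) ` C) = (\<integral>\<^sup>+ y. F x y \<partial>lborel)"
      unfolding F_def by (simp add: emeasure_Int_translation assms nn_integral_cmult)
  qed
  also have "\<dots> = (\<integral>\<^sup>+ y. \<integral>\<^sup>+ x. F x y \<partial>lborel \<partial>lborel)"
    by (rule lborel_pair.Fubini'[symmetric]) measurable
  also have "\<dots> = (\<integral>\<^sup>+ y. (ennreal (exp (- (u \<bullet> y))) * indicator A y) * laplace (uminus ` C) u \<partial>lborel)"
  proof (rule nn_integral_cong)
    fix y
    have "(\<integral>\<^sup>+ x. F x y \<partial>lborel) = (\<integral>\<^sup>+ x. F x y \<partial>distr lborel borel ((+) y))"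
      by (simp add: lborel_distr_plus)
    also have "\<dots> = (\<integral>\<^sup>+ z. F (y + z) y \<partial>lborel)"
      by (rule nn_integral_distr) measurable
    also have "\<dots> = (\<integral>\<^sup>+ z. (ennreal (exp (- (u \<bullet> y))) * indicator A y) *
        (ennreal (exp (- (u \<bullet> z))) * indicator (uminus ` C) z) \<partial>lborel)"
    proof (rule nn_integral_cong)
      fix z
      have "ennreal (exp (- (u \<bullet> (y + z)))) = ennreal (exp (- (u \<bullet> y))) * ennreal (exp (- (u \<bullet> z)))"
        by (simp add: inner_add_right mult_exp_exp flip: ennreal_mult)
      then show "F (y + z) y = (ennreal (exp (- (u \<bullet> y))) * indicator A y) *
          (ennreal (exp (- (u \<bullet> z))) * indicator (uminus ` C) z)"
        by (simp add: F_def neg mult_ac)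
    qed
    also have "\<dots> = (ennreal (exp (- (u \<bullet> y))) * indicator A y) * laplace (uminus ` C) u"
      unfolding laplace_def neg by (rule nn_integral_cmult) measurable
    finally show "(\<integral>\<^sup>+ x. F x y \<partial>lborel) = \<dots>" .
  qed
  also have "\<dots> = laplace A u * laplace (uminus ` C) u"
    unfolding laplace_def[of A] by (rule nn_integral_multc) measurable
  finally show ?thesis by simp
qed

section \<open>Nested cones\<close>

lemma interior_diff_nonempty:
  fixes A B :: "'a::euclidean_space set"
  assumes "convex B" "closed A" "interior B \<noteq> {}" "\<not> B \<subseteq> A"
  shows "interior (B - A) \<noteq> {}"
proof
  assume "interior (B - A) = {}"
  moreover have "interior B - A \<subseteq> interior (B - A)"
    using assms(2) interior_subset[of B] by (intro interior_maximal) (auto simp: open_Diff)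
  ultimately have "closure (interior B) \<subseteq> A"
    using assms(2) by (intro closure_minimal) auto
  then show False
    using convex_closure_interior[of B] assms closure_subset[of B] by auto
qed

lemma measure_diff_inter_null:
  fixes A B C D :: "'a set"
  assumes "A \<inter> C \<in> fmeasurable M" "B \<inter> C \<in> fmeasurable M"
    and "A \<inter> D \<in> fmeasurable M" "B \<inter> D \<in> fmeasurable M"
    and "A \<subseteq> B" "C \<subseteq> D"
    and eq: "measure M (A \<inter> C) + measure M (B \<inter> D) = measure M (A \<inter> D) + measure M (B \<inter> C)"
  shows "measure M ((B - A) \<inter> (D - C)) = 0"
proof -
  have "(B - A) \<inter> (D - C) = (B \<inter> D - A \<inter> D) - (B \<inter> C - A \<inter> C)" using assms by auto
  also have "measure M \<dots> = measure M (B \<inter> D - A \<inter> D) - measure M (B \<inter> C - A \<inter> C)"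
    using assms by (intro measurable_measure_Diff) (auto intro: fmeasurable.Diff)
  also have "measure M (B \<inter> D - A \<inter> D) = measure M (B \<inter> D) - measure M (A \<inter> D)"
    using assms by (intro measurable_measure_Diff) auto
  also have "measure M (B \<inter> C - A \<inter> C) = measure M (B \<inter> C) - measure M (A \<inter> C)"
    using assms by (intro measurable_measure_Diff) auto
  finally show ?thesis using eq by simp
qed

text \<open>Under nesting, the covariogram identity says that \<open>B - A\<close> meets every translate of \<open>D - C\<close> in a null
  set.  If both differences were nonempty they would contain balls, and translating the centre of one
  ball to the centre of the other gives an intersection of positive measure.\<close>

lemma nested_cones_eq:
  fixes A B C D :: "(real ^ 'n) set"
  assumes A: "convex_cone A" "closed A"
    and B: "convex_cone B" "closed B" "B = {0} \<or> interior B \<noteq> {}"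
    and C: "convex_cone C" "closed C"
    and D: "convex_cone D" "closed D" "D = {0} \<or> interior D \<noteq> {}"
    and sub: "A \<subseteq> B" "C \<subseteq> D"
    and fin: "\<And>K L x. K \<in> {A, B} \<Longrightarrow> L \<in> {C, D} \<Longrightarrow> K \<inter> (\<lambda>y. y + x) ` L \<in> lmeasurable"
    and eq: "\<And>x. cross_covariogram A C x + cross_covariogram B D x =
             cross_covariogram A D x + cross_covariogram B C x"
  shows "A = B \<or> C = D"
proof (rule ccontr)
  assume "\<not> ?thesis"
  then have nsub: "\<not> B \<subseteq> A" "\<not> D \<subseteq> C" using sub by auto
  then have int: "interior B \<noteq> {}" "interior D \<noteq> {}"
    using B(3) D(3) A(1) C(1) convex_cone_contains_0 by blast+
  have "convex B" "convex D" using B(1) D(1) by (simp_all add: convex_cone_def)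
  then have "interior (B - A) \<noteq> {}" "interior (D - C) \<noteq> {}"
    using interior_diff_nonempty nsub int A(2) C(2) by metis+
  then obtain b d where b: "b \<in> interior (B - A)" and d: "d \<in> interior (D - C)"
    by blast
  obtain r where r: "r > 0" "ball b r \<subseteq> B - A" using b unfolding mem_interior by blast
  obtain s where s: "s > 0" "ball d s \<subseteq> D - C" using d unfolding mem_interior by blast
  define x where "x = b - d"
  define m where "m = min r s"
  have m_pos: "m > 0" using r s by (simp add: m_def)
  have "ball b m \<subseteq> (B - A) \<inter> ((\<lambda>y. y + x) ` D - (\<lambda>y. y + x) ` C)"
  proof
    fix y assume y: "y \<in> ball b m"
    then have "y - x \<in> ball d s" by (simp add: m_def x_def dist_norm algebra_simps)
    then have "y - x \<in> D - C" using s by blast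
    moreover have "y \<in> B - A" using y r by (auto simp: m_def)
    ultimately show "y \<in> (B - A) \<inter> ((\<lambda>y. y + x) ` D - (\<lambda>y. y + x) ` C)"
      by (auto simp: image_iff intro!: bexI[of _ "y - x"])
  qed
  moreover have "measure lebesgue ((B - A) \<inter> ((\<lambda>y. y + x) ` D - (\<lambda>y. y + x) ` C)) = 0"
    using eq[of x, unfolded cross_covariogram_def] sub
    by (intro measure_diff_inter_null fin) (simp_all add: image_mono)
  moreover have "(B - A) \<inter> ((\<lambda>y. y + x) ` D - (\<lambda>y. y + x) ` C) \<in> lmeasurable"
  proof -
    have "(B - A) \<inter> ((\<lambda>y. y + x) ` D - (\<lambda>y. y + x) ` C) =
      B \<inter> (\<lambda>y. y + x) ` D - (A \<inter> (\<lambda>y. y + x) ` D) - (B \<inter> (\<lambda>y. y + x) ` C)" by blast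
    then show ?thesis using fin by (simp add: fmeasurable.Diff)
  qed
  ultimately have "measure lebesgue (ball b m) \<le> 0"
    using measure_mono_fmeasurable[of "ball b m" "(B - A) \<inter> ((\<lambda>y. y + x) ` D - (\<lambda>y. y + x) ` C)" lebesgue]
    by simp
  moreover have "measure lebesgue (ball b m) = measure lborel (ball b m)" by simp
  ultimately show False using content_ball_pos[OF m_pos, of b] by linarith
qed

section \<open>A functional positive on all cones\<close>

text \<open>When \<open>0\<close> is an extreme point of the hull, removing it leaves a convex set; hence \<open>0\<close> is outside the
  compact convex hull of the unit vectors of \<open>C \<union> D\<close> and can be strictly separated from it.\<close>

lemma strict_dual_Un_nonempty:
  fixes C D :: "'a::euclidean_space set"
  assumes C: "convex_cone C" "closed C" and D: "convex_cone D" "closed D"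
    and ext: "0 extreme_point_of (convex hull (C \<union> D))"
  shows "\<exists>w. w \<in> strict_dual C \<inter> strict_dual D"
proof -
  define S where "S = (C \<union> D) \<inter> sphere 0 1"
  have "compact S" using C D by (auto simp: S_def intro!: closed_Int_compact)
  have "convex (convex hull (C \<union> D) - {0})"
    using ext extreme_point_of_stillconvex[OF convex_convex_hull] by blast
  moreover have "S \<subseteq> convex hull (C \<union> D) - {0}"
    using hull_subset[of "C \<union> D" convex] by (auto simp: S_def)
  ultimately have "convex hull S \<subseteq> convex hull (C \<union> D) - {0}" by (intro hull_minimal) auto
  then have "0 \<notin> convex hull S" by blast
  then obtain w b where w: "b > 0" "\<And>y. y \<in> convex hull S \<Longrightarrow> w \<bullet> y > b"
    using separating_hyperplane_closed_0[of "convex hull S"] \<open>compact S\<close>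
    by (metis compact_convex_hull compact_imp_closed convex_convex_hull)
  have pos: "w \<bullet> y > 0" if "convex_cone K" "K \<subseteq> C \<union> D" "y \<in> K" "y \<noteq> 0" for K y
  proof -
    have "(1 / norm y) *\<^sub>R y \<in> K" using that by (intro convex_cone_scaleR) auto
    then have "(1 / norm y) *\<^sub>R y \<in> S" using that by (auto simp: S_def)
    then have "w \<bullet> ((1 / norm y) *\<^sub>R y) > 0"
      using w hull_subset[of S convex] by (meson dual_order.strict_trans subsetD)
    then show ?thesis using \<open>y \<noteq> 0\<close> by (simp add: zero_less_divide_iff)
  qed
  have "w \<in> strict_dual C" using C pos by (intro strict_dualI) auto
  moreover have "w \<in> strict_dual D" using D pos by (intro strict_dualI) auto
  ultimately show ?thesis by blast
qed

lemma add_large_multiple_in_strict_dual: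
  assumes "e \<in> strict_dual A"
  shows "\<forall>\<^sub>F t in at_top. t *\<^sub>R e + w \<in> strict_dual A"
proof -
  obtain c where c: "c > 0" "\<And>y. y \<in> A \<Longrightarrow> c * norm y \<le> e \<bullet> y"
    using assms by (auto simp: strict_dual_def)
  have "t *\<^sub>R e + w \<in> strict_dual A" if t: "t \<ge> (norm w + 1) / c" for t
  proof -
    have t0: "t \<ge> 0" using t c(1) by (meson add_nonneg_nonneg divide_nonneg_pos norm_ge_zero order_trans zero_le_one)
    have "1 * norm y \<le> (t *\<^sub>R e + w) \<bullet> y" if "y \<in> A" for y
    proof -
      have "(norm w + 1) * norm y \<le> t * c * norm y"
        using t c(1) by (intro mult_right_mono) (auto simp: field_simps)
      also have "\<dots> \<le> t * (e \<bullet> y)" using c(2)[OF that] t0 by (simp add: mult.assoc mult_left_mono)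
      finally have "(norm w + 1) * norm y \<le> t * (e \<bullet> y)" .
      moreover have "\<bar>w \<bullet> y\<bar> \<le> norm w * norm y" by (rule Cauchy_Schwarz_ineq2)
      ultimately show ?thesis by (simp add: inner_add_left algebra_simps abs_le_iff)
    qed
    then show ?thesis unfolding strict_dual_def by (blast intro: zero_less_one)
  qed
  then show ?thesis by (auto simp: eventually_at_top_linorder)
qed

lemma strict_dual_add_nonneg:
  assumes "w \<in> strict_dual C" "\<And>y. y \<in> C \<Longrightarrow> e \<bullet> y \<ge> 0" "t \<ge> 0"
  shows "t *\<^sub>R e + w \<in> strict_dual C"
proof -
  obtain c where "c > 0" "\<And>y. y \<in> C \<Longrightarrow> c * norm y \<le> w \<bullet> y"
    using assms(1) by (auto simp: strict_dual_def)
  then show ?thesis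
    using assms(2,3) unfolding strict_dual_def
    by (force simp: inner_add_left intro!: exI[of _ c] add_increasing)
qed

lemma convex_cone_uminus:
  fixes C :: "'a::real_vector set"
  assumes "convex_cone C"
  shows "convex_cone (uminus ` C)"
proof -
  have "linear (uminus :: 'a \<Rightarrow> 'a)" by (intro linearI) auto
  with assms show ?thesis by (intro convex_cone_linear_image conjI)
qed

section \<open>The product identity and the conclusion\<close>

lemma laplace_products_eq:
  fixes A B C D :: "(real ^ 'n) set"
  assumes clo: "closed A" "closed B" "closed C" "closed D"
    and fin: "\<And>K L x. K \<in> {A, B} \<Longrightarrow> L \<in> {C, D} \<Longrightarrow> K \<inter> (\<lambda>y. y + x) ` L \<in> lmeasurable"
    and eq: "\<And>x. cross_covariogram A C x + cross_covariogram B D x =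
             cross_covariogram A D x + cross_covariogram B C x"
  shows "laplace A u * laplace (uminus ` C) u + laplace B u * laplace (uminus ` D) u =
    laplace A u * laplace (uminus ` D) u + laplace B u * laplace (uminus ` C) u"
proof -
  note [measurable] = borel_closed[OF clo(1)] borel_closed[OF clo(2)] borel_closed[OF clo(3)] borel_closed[OF clo(4)]
  define G where "G K L x = emeasure lborel (K \<inter> (\<lambda>y. y + x) ` L)" for K L and x :: "real ^ 'n"
  have meas [measurable]: "G K L \<in> borel_measurable borel" if "K \<in> {A, B}" "L \<in> {C, D}" for K L
  proof -
    have [measurable]: "K \<in> sets borel" "L \<in> sets borel" using that clo by auto
    have "G K L = (\<lambda>x. \<integral>\<^sup>+ y. indicator K y * indicator L (y - x) \<partial>lborel)"
      by (simp add: G_def[abs_def] emeasure_Int_translation)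
    then show ?thesis by simp
  qed
  have G_eq: "G K L x = ennreal (cross_covariogram K L x)" if KL: "K \<in> {A, B}" "L \<in> {C, D}" for K L x
  proof -
    have "closed K" "closed L" using KL clo by auto
    moreover have "(\<lambda>y. y + x) ` L = (+) x ` L" by (simp add: add.commute)
    ultimately have "K \<inter> (\<lambda>y. y + x) ` L \<in> sets borel"
      by (metis borel_closed closed_Int closed_translation)
    then have "G K L x = emeasure lebesgue (K \<inter> (\<lambda>y. y + x) ` L)" by (simp add: G_def)
    then show ?thesis
      using fin[OF KL, of x] unfolding cross_covariogram_def
      by (simp add: emeasure_eq_measure2)
  qed
  have nonneg: "cross_covariogram K L x \<ge> 0" for K L and x :: "real ^ 'n"
    by (simp add: cross_covariogram_def)
  have sum_eq: "G A C x + G B D x = G A D x + G B C x" for x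
    using eq[of x] by (simp add: G_eq nonneg flip: ennreal_plus)
  have "laplace A u * laplace (uminus ` C) u + laplace B u * laplace (uminus ` D) u =
      (\<integral>\<^sup>+ x. ennreal (exp (- (u \<bullet> x))) * (G A C x + G B D x) \<partial>lborel)"
    unfolding distrib_left by (subst nn_integral_add) (simp_all add: laplace_mult clo G_def[symmetric])
  also have "\<dots> = laplace A u * laplace (uminus ` D) u + laplace B u * laplace (uminus ` C) u"
    unfolding sum_eq distrib_left by (subst nn_integral_add) (simp_all add: laplace_mult clo G_def[symmetric])
  finally show ?thesis .
qed

lemma ennreal_cross_products_eq:
  fixes a b c d :: ennreal
  assumes "a < \<infinity>" "b < \<infinity>" "c < \<infinity>" "d < \<infinity>" "a * c + b * d = a * d + b * c"
  shows "a = b \<or> c = d"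
proof -
  obtain a' b' c' d' where r: "a = ennreal a'" "b = ennreal b'" "c = ennreal c'" "d = ennreal d'"
    and nn: "a' \<ge> 0" "b' \<ge> 0" "c' \<ge> 0" "d' \<ge> 0"
    using assms(1-4) by (cases a; cases b; cases c; cases d) auto
  have "a' * c' + b' * d' = a' * d' + b' * c'"
    using assms(5) nn by (simp add: r flip: ennreal_mult ennreal_plus)
  then have "(a' - b') * (c' - d') = 0" by (simp add: algebra_simps)
  then show ?thesis by (auto simp: r)
qed

text \<open>If neither the transforms of \<open>A\<close> and \<open>B\<close> nor those of \<open>C\<close> and \<open>D\<close> coincide, then both pairs differ at
  a common point near \<open>u\<close>: this is the absence of zero divisors among analytic functions on a connected
  domain.\<close>

lemma laplace_zero_divisor_free:
  fixes A B C D :: "'a::euclidean_space set"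
  assumes borel: "A \<in> sets borel" "B \<in> sets borel" "C \<in> sets borel" "D \<in> sets borel"
    and u: "u \<in> strict_dual A \<inter> strict_dual B" "u \<in> strict_dual C \<inter> strict_dual D"
    and v: "v \<in> strict_dual A \<inter> strict_dual B" "laplace A v \<noteq> laplace B v"
    and v': "v' \<in> strict_dual C \<inter> strict_dual D" "laplace C v' \<noteq> laplace D v'"
  obtains p where "p \<in> strict_dual A \<inter> strict_dual B \<inter> (strict_dual C \<inter> strict_dual D)"
    "laplace A p \<noteq> laplace B p" "laplace C p \<noteq> laplace D p"
proof -
  define U where "U = strict_dual A \<inter> strict_dual B \<inter> (strict_dual C \<inter> strict_dual D)"
  have "open U" by (simp add: U_def open_Int open_strict_dual)
  have near: "\<forall>\<^sub>F t in at (0::real). p + t *\<^sub>R w \<in> U" if "p \<in> U" for p w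
  proof -
    have "((\<lambda>t::real. p + t *\<^sub>R w) \<longlongrightarrow> p) (at 0)" by (auto intro!: tendsto_eq_intros)
    then show ?thesis using \<open>open U\<close> that by (rule topological_tendstoD)
  qed
  have "u \<in> U" using u by (simp add: U_def)
  have "\<forall>\<^sub>F t in at (0::real). laplace A (u + t *\<^sub>R (v - u)) \<noteq> laplace B (u + t *\<^sub>R (v - u))"
    using u v by (intro eventually_laplace_neq[OF borel(1,2), where s = 1]) auto
  with near[OF \<open>u \<in> U\<close>, of "v - u"]
  have "\<forall>\<^sub>F t in at (0::real). u + t *\<^sub>R (v - u) \<in> U \<and> laplace A (u + t *\<^sub>R (v - u)) \<noteq> laplace B (u + t *\<^sub>R (v - u))"
    by eventually_elim simp
  then obtain q where q: "q \<in> U" "laplace A q \<noteq> laplace B q"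
    using eventually_happens'[OF at_neq_bot] by blast
  \<comment> \<open>Near \<open>q\<close> on the line towards \<open>v'\<close> the first inequality persists, because it holds at \<open>q\<close> itself.\<close>
  have "\<forall>\<^sub>F t in at (0::real). laplace A (q + t *\<^sub>R (v' - q)) \<noteq> laplace B (q + t *\<^sub>R (v' - q))"
    using q by (intro eventually_laplace_neq[OF borel(1,2), where s = 0]) (auto simp: U_def)
  moreover have "\<forall>\<^sub>F t in at (0::real). laplace C (q + t *\<^sub>R (v' - q)) \<noteq> laplace D (q + t *\<^sub>R (v' - q))"
    using q v' by (intro eventually_laplace_neq[OF borel(3,4), where s = 1]) (auto simp: U_def)
  ultimately have "\<forall>\<^sub>F t in at (0::real). q + t *\<^sub>R (v' - q) \<in> U \<and>
      laplace A (q + t *\<^sub>R (v' - q)) \<noteq> laplace B (q + t *\<^sub>R (v' - q)) \<and>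
      laplace C (q + t *\<^sub>R (v' - q)) \<noteq> laplace D (q + t *\<^sub>R (v' - q))"
    using near[OF q(1), of "v' - q"] by eventually_elim simp
  then obtain p where "p \<in> U" "laplace A p \<noteq> laplace B p" "laplace C p \<noteq> laplace D p"
    using eventually_happens'[OF at_neq_bot] by blast
  then show ?thesis using that by (simp add: U_def)
qed

theorem lemma5p1:
  fixes A B C D :: "(real ^ 'n) set" and k :: 'n
  assumes "2 \<le> CARD('n)"
    and "\<forall>K \<in> {A, B, C, D}. convex_cone K \<and> closed K \<and> (K = {0} \<or> interior K \<noteq> {})"
    and "A \<union> B \<subseteq> {x. x $ k \<ge> 0}"
    and "A \<inter> {x. x $ k = 0} = {0}" and "B \<inter> {x. x $ k = 0} = {0}"
    and "C \<union> D \<subseteq> {x. x $ k \<le> 0}"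
    and "pointed_cone (convex hull (C \<union> D)) \<or>
         ((A \<subseteq> B \<or> B \<subseteq> A) \<and> (C \<subseteq> D \<or> D \<subseteq> C))"
    and "\<forall>x. cross_covariogram A C x + cross_covariogram B D x =
             cross_covariogram A D x + cross_covariogram B C x"
  shows "A = B \<or> C = D"
proof -
  have cone: "convex_cone A" "convex_cone B" "convex_cone C" "convex_cone D"
    and clo: "closed A" "closed B" "closed C" "closed D"
    and full: "A = {0} \<or> interior A \<noteq> {}" "B = {0} \<or> interior B \<noteq> {}"
      "C = {0} \<or> interior C \<noteq> {}" "D = {0} \<or> interior D \<noteq> {}"
    using assms(2) by auto
  have fin: "K \<inter> (\<lambda>y. y + x) ` L \<in> lmeasurable" if "K \<in> {A, B}" "L \<in> {C, D}" for K L x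
  proof (rule cross_covariogram_finite)
    show "convex_cone K" "closed K" "closed L" using that cone clo by auto
    show "K \<subseteq> {x. 0 \<le> x $ k}" "K \<inter> {x. x $ k = 0} = {0}" "L \<subseteq> {x. x $ k \<le> 0}"
      using that assms(3-6) by auto
  qed
  have eq: "cross_covariogram A C x + cross_covariogram B D x =
            cross_covariogram A D x + cross_covariogram B C x" for x
    using assms(8) by blast
  from assms(7) show ?thesis
  proof
    assume "(A \<subseteq> B \<or> B \<subseteq> A) \<and> (C \<subseteq> D \<or> D \<subseteq> C)"
    then consider "A \<subseteq> B" "C \<subseteq> D" | "A \<subseteq> B" "D \<subseteq> C" | "B \<subseteq> A" "C \<subseteq> D" | "B \<subseteq> A" "D \<subseteq> C"
      by blast
    then show ?thesis
    proof cases
      case 1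
      have "A = B \<or> C = D"
      proof (rule nested_cones_eq[OF cone(1) clo(1) cone(2) clo(2) full(2) cone(3) clo(3) cone(4) clo(4) full(4) 1])
        show "K \<inter> (\<lambda>y. y + x) ` L \<in> lmeasurable" if "K \<in> {A, B}" "L \<in> {C, D}" for K L x
          using that by (intro fin) blast+
        show "cross_covariogram A C x + cross_covariogram B D x =
            cross_covariogram A D x + cross_covariogram B C x" for x
          using eq[of x] by linarith
      qed
      then show ?thesis by blast
    next
      case 2
      have "A = B \<or> D = C"
      proof (rule nested_cones_eq[OF cone(1) clo(1) cone(2) clo(2) full(2) cone(4) clo(4) cone(3) clo(3) full(3) 2])
        show "K \<inter> (\<lambda>y. y + x) ` L \<in> lmeasurable" if "K \<in> {A, B}" "L \<in> {D, C}" for K L x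
          using that by (intro fin) blast+
        show "cross_covariogram A D x + cross_covariogram B C x =
            cross_covariogram A C x + cross_covariogram B D x" for x
          using eq[of x] by linarith
      qed
      then show ?thesis by blast
    next
      case 3
      have "B = A \<or> C = D"
      proof (rule nested_cones_eq[OF cone(2) clo(2) cone(1) clo(1) full(1) cone(3) clo(3) cone(4) clo(4) full(4) 3])
        show "K \<inter> (\<lambda>y. y + x) ` L \<in> lmeasurable" if "K \<in> {B, A}" "L \<in> {C, D}" for K L x
          using that by (intro fin) blast+
        show "cross_covariogram B C x + cross_covariogram A D x =
            cross_covariogram B D x + cross_covariogram A C x" for x
          using eq[of x] by linarith
      qed
      then show ?thesis by blast
    next
      case 4
      have "B = A \<or> D = C"
      proof (rule nested_cones_eq[OF cone(2) clo(2) cone(1) clo(1) full(1) cone(4) clo(4) cone(3) clo(3) full(3) 4])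
        show "K \<inter> (\<lambda>y. y + x) ` L \<in> lmeasurable" if "K \<in> {B, A}" "L \<in> {D, C}" for K L x
          using that by (intro fin) blast+
        show "cross_covariogram B D x + cross_covariogram A C x =
            cross_covariogram B C x + cross_covariogram A D x" for x
          using eq[of x] by linarith
      qed
      then show ?thesis by blast
    qed
  next
    assume "pointed_cone (convex hull (C \<union> D))"
    then have "0 extreme_point_of (convex hull (C \<union> D))" by (simp add: pointed_cone_def)
    then obtain w where "w \<in> strict_dual C \<inter> strict_dual D"
      using strict_dual_Un_nonempty[OF cone(3) clo(3) cone(4) clo(4)] by blast
    define C' where "C' = uminus ` C"
    define D' where "D' = uminus ` D"
    have cone': "convex_cone C'" "convex_cone D'"
      using cone by (auto simp: C'_def D'_def convex_cone_uminus)
    have clo': "closed C'" "closed D'"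
      using clo by (auto simp: C'_def D'_def closed_negations)
    have full': "C' = {0} \<or> interior C' \<noteq> {}" "D' = {0} \<or> interior D' \<noteq> {}"
      using full by (auto simp: C'_def D'_def interior_negations)
    define e :: "real ^ 'n" where "e = axis k 1"
    have e: "e \<bullet> y = y $ k" for y by (simp add: e_def inner_axis')
    have eA: "e \<in> strict_dual A" and eB: "e \<in> strict_dual B"
    proof -
      have pos: "0 < e \<bullet> y" if "K \<subseteq> {x. 0 \<le> x $ k}" "K \<inter> {x. x $ k = 0} = {0}" "y \<in> K" "y \<noteq> 0" for K y
        using that by (force simp: e less_le)
      show "e \<in> strict_dual A" "e \<in> strict_dual B"
        using assms(3-5) by (intro strict_dualI cone clo pos; blast)+
    qed
    have w': "- w \<in> strict_dual C'" "- w \<in> strict_dual D'"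
      using \<open>w \<in> strict_dual C \<inter> strict_dual D\<close>
      by (auto simp: strict_dual_def C'_def D'_def)
    \<comment> \<open>A large multiple of \<open>e\<close> outweighs \<open>- w\<close> on \<open>A\<close> and \<open>B\<close>, and \<open>e\<close> is nonnegative on \<open>- C\<close> and \<open>- D\<close>.\<close>
    have "\<forall>\<^sub>F t in at_top. t *\<^sub>R e + - w \<in> strict_dual A \<and> t *\<^sub>R e + - w \<in> strict_dual B \<and> t \<ge> 0"
      by (intro eventually_conj add_large_multiple_in_strict_dual eA eB eventually_ge_at_top)
    then obtain t where t: "t *\<^sub>R e + - w \<in> strict_dual A" "t *\<^sub>R e + - w \<in> strict_dual B" "t \<ge> 0"
      using eventually_happens'[OF trivial_limit_at_top_linorder] by blast
    define u where "u = t *\<^sub>R e + - w"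
    have u: "u \<in> strict_dual A \<inter> strict_dual B" "u \<in> strict_dual C' \<inter> strict_dual D'"
    proof -
      show "u \<in> strict_dual A \<inter> strict_dual B" using t by (simp add: u_def)
      have nonneg: "e \<bullet> y \<ge> 0" if "y \<in> C' \<union> D'" for y
        using that assms(6) by (auto simp: C'_def D'_def e)
      have "u \<in> strict_dual C'" "u \<in> strict_dual D'"
        unfolding u_def by (rule strict_dual_add_nonneg[OF _ nonneg \<open>t \<ge> 0\<close>]; use w' in blast)+
      then show "u \<in> strict_dual C' \<inter> strict_dual D'" by blast
    qed
    show ?thesis
    proof (rule ccontr)
      assume "\<not> ?thesis"
      then have "A \<noteq> B" "C' \<noteq> D'"
        by (auto simp: C'_def D'_def inj_image_eq_iff)
      obtain v where v: "v \<in> strict_dual A \<inter> strict_dual B" "laplace A v \<noteq> laplace B v"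
        using laplace_separates[of A B u] cone clo full u \<open>A \<noteq> B\<close> by blast
      obtain v' where v': "v' \<in> strict_dual C' \<inter> strict_dual D'" "laplace C' v' \<noteq> laplace D' v'"
        using laplace_separates[of C' D' u] cone' clo' full' u \<open>C' \<noteq> D'\<close> by blast
      obtain p where p: "p \<in> strict_dual A \<inter> strict_dual B \<inter> (strict_dual C' \<inter> strict_dual D')"
        "laplace A p \<noteq> laplace B p" "laplace C' p \<noteq> laplace D' p"
        using laplace_zero_divisor_free[OF borel_closed[OF clo(1)] borel_closed[OF clo(2)]
          borel_closed[OF clo'(1)] borel_closed[OF clo'(2)] u v v'] by blast
      have "laplace A p * laplace C' p + laplace B p * laplace D' p =
          laplace A p * laplace D' p + laplace B p * laplace C' p"
        unfolding C'_def D'_def by (rule laplace_products_eq) (use clo fin eq in auto)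
      then show False
        using ennreal_cross_products_eq[of "laplace A p" "laplace B p" "laplace C' p" "laplace D' p"]
          p laplace_finite[of p] by blast
    qed
  qed
qed

end
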